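(* Let $Q=T[H_1,\dots,H_t]$ be a strong semicomplete composition with $T\notin\mathcal{T}_1$. Then every minimal separator $S$ of $Q$ induces in $\overline{U(Q)}$ a subgraph which consists of some connected components of $\overline{U(Q)}$ (that is, $S$ is a union of vertex sets of connected components of $\overline{U(Q)}$). Moreover, each vertex $s\in S$ is adjacent in $Q$ to every vertex of $Q-S$ (i.e., for every $x\in V(Q)\setminus S$ there is at least one arc between $s$ and $x$ in $Q$).
   Context: Digraphs are finite, without loops or parallel arcs (2-cycles are allowed). A digraph is semicomplete if there is at least one arc between every pair of distinct vertices. Let $T$ be a digraph with vertices $u_1,\dots,u_t$ ($t\ge 2$) and let $H_1,\dots,H_t$ be pairwise disjoint nonempty digraphs, where $H_i$ has $n_i$ vertices. The composition $Q=T[H_1,\dots,H_t]$ is the digraph with vertex set $\bigcup_i V(H_i)$ and arc set $\bigcup_{i=1}^t A(H_i)\cup\{xy : x\in V(H_i),\ y\in V(H_p),\ u_iu_p\in A(T)\}$. It is a semicomplete composition if $T$ is semicomplete. A digraph is strong if for every ordered pair of vertices $(x,y)$ there is a directed path from $x$ to $y$ (a one-vertex digraph is strong). $\mathcal{T}_1$ is the set of all semicomplete digraphs $T$ for which there exists a vertex $u$ such that $uv,vu\in A(T)$ for every $v\in V(T)\setminus\{u\}$. $U(D)$ denotes the underlying undirected graph of $D$, and $\overline{G}$ the complement of a graph $G$. A set $S\subseteq V(D)$ is a separator of $D$ if $D-S$ is not strong; a separator is minimal if no proper subset of it is a separator. *)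

theory Defs
  imports "Graph_Theory.Graph_Theory" "HOL-Library.Disjoint_Sets"
begin

definition semicomplete :: "'a pair_pre_digraph \<Rightarrow> bool" where
  "semicomplete D \<longleftrightarrow>
     (\<forall>x\<in>pverts D. \<forall>y\<in>pverts D. x \<noteq> y \<longrightarrow> (x, y) \<in> parcs D \<or> (y, x) \<in> parcs D)"

text \<open>The factors are indexed by the vertices of \<open>T\<close> themselves: \<open>H u\<close> is the digraph
  substituted for the vertex \<open>u\<close>.\<close>

definition composition ::
  "'i pair_pre_digraph \<Rightarrow> ('i \<Rightarrow> 'a pair_pre_digraph) \<Rightarrow> 'a pair_pre_digraph" where
  "composition T H =
     \<lparr> pverts = (\<Union>u\<in>pverts T. pverts (H u)),
       parcs = (\<Union>u\<in>pverts T. parcs (H u)) \<union>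
               {(x, y). \<exists>u v. (u, v) \<in> parcs T \<and> x \<in> pverts (H u) \<and> y \<in> pverts (H v)} \<rparr>"

text \<open>Unlike \<^const>\<open>strongly_connected\<close>, this holds for the null digraph, so the full vertex
  set of a digraph is never a separator.\<close>

definition strong :: "('a, 'b) pre_digraph \<Rightarrow> bool" where
  "strong D \<longleftrightarrow> (\<forall>x\<in>verts D. \<forall>y\<in>verts D. x \<rightarrow>\<^sup>*\<^bsub>D\<^esub> y)"

definition class_T1 :: "'a pair_pre_digraph set" where
  "class_T1 = {T. pair_digraph T \<and> semicomplete T \<and>
     (\<exists>u\<in>pverts T. \<forall>v\<in>pverts T - {u}. (u, v) \<in> parcs T \<and> (v, u) \<in> parcs T)}"

definition separator :: "('a, 'b) pre_digraph \<Rightarrow> 'a set \<Rightarrow> bool" where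
  "separator D S \<longleftrightarrow> S \<subseteq> verts D \<and> \<not> strong (D \<restriction> (verts D - S))"

definition minimal_separator :: "('a, 'b) pre_digraph \<Rightarrow> 'a set \<Rightarrow> bool" where
  "minimal_separator D S \<longleftrightarrow> separator D S \<and> (\<forall>S'. S' \<subset> S \<longrightarrow> \<not> separator D S')"

text \<open>Undirected graphs are symmetric digraphs. The underlying graph of a digraph is
  \<^const>\<open>mk_symmetric\<close>, and the connected components of a symmetric digraph are its
  strongly connected components \<^const>\<open>pre_digraph.sccs\<close>.\<close>

definition graph_complement :: "'a pair_pre_digraph \<Rightarrow> 'a pair_pre_digraph" where
  "graph_complement G =
     \<lparr> pverts = pverts G,
       parcs = {(x, y). x \<in> pverts G \<and> y \<in> pverts G \<and> x \<noteq> y \<and> (x, y) \<notin> parcs G} \<rparr>"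

lemma strong_conv_strongly_connected:
  "strong D \<longleftrightarrow> verts D = {} \<or> strongly_connected D"
  by (auto simp: strong_def strongly_connected_def)

lemma pair_digraph_composition:
  assumes T: "pair_digraph T"
    and H: "\<And>u. u \<in> pverts T \<Longrightarrow> pair_digraph (H u)"
    and disj: "disjoint_family_on (\<lambda>u. pverts (H u)) (pverts T)"
  shows "pair_digraph (composition T H)"
proof -
  interpret T: pair_digraph T by (rule T)
  have wf: "x \<in> pverts (H u)" "y \<in> pverts (H u)" "x \<noteq> y"
    if "u \<in> pverts T" "(x, y) \<in> parcs (H u)" for u x y
  proof -
    interpret pair_digraph "H u" by (rule H[OF that(1)])
    show "x \<in> pverts (H u)" "y \<in> pverts (H u)" "x \<noteq> y"
      using that(2) in_arcsD1 in_arcsD2 no_loops' by auto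
  qed
  let ?Q = "composition T H"
  have fin: "finite (pverts ?Q)"
    using T.pair_finite_verts H
    by (auto simp: composition_def pair_digraph_def pair_fin_digraph_def pair_fin_digraph_axioms_def)
  have arcs: "x \<in> pverts ?Q \<and> y \<in> pverts ?Q \<and> x \<noteq> y" if xy: "(x, y) \<in> parcs ?Q" for x y
  proof -
    consider u where "u \<in> pverts T" "(x, y) \<in> parcs (H u)"
      | u v where "(u, v) \<in> parcs T" "x \<in> pverts (H u)" "y \<in> pverts (H v)"
      using xy by (auto simp: composition_def)
    then show ?thesis
    proof cases
      case 1
      then show ?thesis using wf[OF 1] by (auto simp: composition_def)
    next
      case 2
      then have "u \<in> pverts T" "v \<in> pverts T" "u \<noteq> v"
        using T.in_arcsD1 T.in_arcsD2 T.no_loops' by auto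
      then show ?thesis using 2 disj by (auto simp: composition_def disjoint_family_on_def)
    qed
  qed
  then have "parcs ?Q \<subseteq> pverts ?Q \<times> pverts ?Q" by auto
  then have "finite (parcs ?Q)" using fin by (meson finite_SigmaI finite_subset)
  then show ?thesis using fin arcs by unfold_locales (auto simp: prod_eq_iff)
qed

lemma pair_graph_graph_complement_mk_symmetric:
  assumes "pair_digraph D"
  shows "pair_graph (graph_complement (mk_symmetric D))"
proof -
  interpret pair_digraph D by (rule assms)
  have "finite {(x, y). x \<in> pverts D \<and> y \<in> pverts D \<and> x \<noteq> y \<and> (x, y) \<notin> parcs (mk_symmetric D)}"
    by (rule finite_subset[of _ "pverts D \<times> pverts D"]) (auto simp: pair_finite_verts)
  then show ?thesis
    using pair_finite_verts
    by unfold_locales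
      (auto simp: graph_complement_def symmetric_def sym_def parcs_mk_symmetric)
qed

end

theory Submission
  imports Defs
begin

text \<open>Suppose \<open>s \<in> S\<close> and \<open>x \<notin> S\<close> are not adjacent. As \<open>T\<close> is semicomplete, both lie in one
  factor \<open>H u\<close>, so they have the same in- and out-neighbours outside \<open>H u\<close>. Split the vertices
  outside \<open>S\<close> into nonempty \<open>A\<close> and \<open>B\<close> without arcs from \<open>B\<close> to \<open>A\<close>; by minimality of \<open>S\<close> some
  arc leads from \<open>B\<close> to \<open>s\<close> and some arc from \<open>s\<close> to \<open>A\<close>. Since \<open>x\<close> cannot replace \<open>s\<close> on this
  path, \<open>H u\<close> meets both \<open>A\<close> and \<open>B\<close>. Hence the vertices of \<open>A\<close> outside \<open>H u\<close> receive no arc from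
  \<open>H u\<close>, and those of \<open>B\<close> outside \<open>H u\<close> send none to \<open>H u\<close>. If such vertices exist, \<open>S\<close> without
  the vertices of \<open>H u\<close> is a smaller separator. Otherwise \<open>S\<close> contains every other factor, and as
  \<open>T\<close> is not in \<open>\<T>\<^sub>1\<close> there is a vertex \<open>w\<close> not forming a 2-cycle with \<open>u\<close>: deleting everything
  except \<open>H u\<close> and \<open>H w\<close> leaves a digraph that is not strong, which again contradicts minimality.\<close>

text \<open>A path from \<open>B\<close> to its complement must use an arc leaving \<open>B\<close>;
  conversely, if \<open>q\<close> is unreachable from \<open>p\<close>, no arc leaves the set of
  vertices reachable from \<open>p\<close>.\<close>

lemma (in wf_digraph) strong_iff_no_cut:
  "strong G \<longleftrightarrow>
    (\<forall>B \<subseteq> verts G. B \<noteq> {} \<longrightarrow> B \<noteq> verts G \<longrightarrow> (\<exists>b\<in>B. \<exists>a\<in>verts G - B. b \<rightarrow>\<^bsub>G\<^esub> a))"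
proof (intro iffI allI impI)
  fix B assume str: "strong G" and B: "B \<subseteq> verts G" "B \<noteq> {}" "B \<noteq> verts G"
  then obtain p q where pq: "p \<in> B" "q \<in> verts G" "q \<notin> B" by auto
  then have "p \<rightarrow>\<^sup>* q" using str B by (auto simp: strong_def)
  then show "\<exists>b\<in>B. \<exists>a\<in>verts G - B. b \<rightarrow>\<^bsub>G\<^esub> a"
    using pq
  \<comment> \<open>For a last arc from \<open>y\<close> to \<open>z\<close> with \<open>z\<close>
    outside \<open>B\<close>: if \<open>y\<close> lies in \<open>B\<close>, this arc leaves
    \<open>B\<close>; otherwise the induction hypothesis applies to \<open>y\<close>.\<close>
  proof (induct rule: reachable_induct)
    case (step y z)
    then show ?case using adj_in_verts by blast
  qed simp
next
  assume cut: "\<forall>B \<subseteq> verts G. B \<noteq> {} \<longrightarrow> B \<noteq> verts G \<longrightarrow>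
    (\<exists>b\<in>B. \<exists>a\<in>verts G - B. b \<rightarrow>\<^bsub>G\<^esub> a)"
  have "p \<rightarrow>\<^sup>* q" if pq: "p \<in> verts G" "q \<in> verts G" for p q
  proof (rule ccontr)
    assume nr: "\<not> p \<rightarrow>\<^sup>* q"
    let ?B = "{z. p \<rightarrow>\<^sup>* z}"
    have "?B \<subseteq> verts G" "p \<in> ?B" "q \<notin> ?B"
      using pq nr by (auto dest: reachable_in_verts)
    then obtain b a where "b \<in> ?B" "a \<notin> ?B" "b \<rightarrow> a"
      using cut pq by (metis DiffD2 empty_iff)
    then show False using reachable_adj_trans by blast
  qed
  then show "strong G" by (simp add: strong_def)
qed

text \<open>The cut criterion for the digraph left after deleting \<open>S\<close>. In this form a
  given separator yields two sides to work with, and a smaller separator is exhibited by naming its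
  sides.\<close>

lemma (in wf_digraph) separator_iff_cut:
  "separator G S \<longleftrightarrow> S \<subseteq> verts G \<and>
    (\<exists>A B. A \<noteq> {} \<and> B \<noteq> {} \<and> A \<inter> B = {} \<and> A \<union> B = verts G - S \<and>
      (\<forall>b\<in>B. \<forall>a\<in>A. \<not> b \<rightarrow>\<^bsub>G\<^esub> a))"
proof -
  let ?X = "verts G - S"
  interpret R: wf_digraph "G \<restriction> ?X" by (rule wellformed_induce_subgraph)
  have dom: "b \<rightarrow>\<^bsub>G \<restriction> ?X\<^esub> a \<longleftrightarrow> b \<rightarrow>\<^bsub>G\<^esub> a" if "b \<in> ?X" "a \<in> ?X" for a b
    using that by (auto simp: arcs_ends_conv)
  have "\<not> strong (G \<restriction> ?X) \<longleftrightarrow>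
      (\<exists>B \<subseteq> ?X. B \<noteq> {} \<and> B \<noteq> ?X \<and> (\<forall>b\<in>B. \<forall>a\<in>?X - B. \<not> b \<rightarrow>\<^bsub>G \<restriction> ?X\<^esub> a))"
    unfolding R.strong_iff_no_cut induce_subgraph_verts by blast
  also have "\<dots> \<longleftrightarrow> (\<exists>B \<subseteq> ?X. B \<noteq> {} \<and> B \<noteq> ?X \<and> (\<forall>b\<in>B. \<forall>a\<in>?X - B. \<not> b \<rightarrow>\<^bsub>G\<^esub> a))"
    using dom by (meson DiffD1 subsetD)
  also have "\<dots> \<longleftrightarrow> (\<exists>A B. A \<noteq> {} \<and> B \<noteq> {} \<and> A \<inter> B = {} \<and> A \<union> B = ?X \<and>
      (\<forall>b\<in>B. \<forall>a\<in>A. \<not> b \<rightarrow>\<^bsub>G\<^esub> a))" (is "?L \<longleftrightarrow> ?R")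
  proof
    assume ?L
    then obtain B where "B \<subseteq> ?X" "B \<noteq> {}" "B \<noteq> ?X" "\<forall>b\<in>B. \<forall>a\<in>?X - B. \<not> b \<rightarrow>\<^bsub>G\<^esub> a"
      by blast
    then show ?R by (intro exI[of _ "?X - B"] exI[of _ B]) blast
  next
    assume ?R
    then obtain A B where AB: "A \<noteq> {}" "B \<noteq> {}" "A \<inter> B = {}" "A \<union> B = ?X"
      "\<forall>b\<in>B. \<forall>a\<in>A. \<not> b \<rightarrow>\<^bsub>G\<^esub> a" by blast
    then have "?X - B = A" by blast
    with AB show ?L by (intro exI[of _ B]) auto
  qed
  finally show ?thesis by (simp add: separator_def)
qed

text \<open>Disjointness makes the factor of a vertex unique, so an arc between different factors
  comes neither from inside a factor nor from any other arc of \<open>T\<close>.\<close>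

lemma parcs_composition_iff:
  assumes T: "pair_digraph T"
    and H: "\<And>u. u \<in> pverts T \<Longrightarrow> pair_digraph (H u)"
    and disj: "disjoint_family_on (\<lambda>u. pverts (H u)) (pverts T)"
    and uv: "u \<in> pverts T" "v \<in> pverts T" "u \<noteq> v"
    and xy: "x \<in> pverts (H u)" "y \<in> pverts (H v)"
  shows "(x, y) \<in> parcs (composition T H) \<longleftrightarrow> (u, v) \<in> parcs T"
proof -
  interpret T: pair_digraph T by (rule T)
  have uniq: "i = j" if "i \<in> pverts T" "j \<in> pverts T" "z \<in> pverts (H i)" "z \<in> pverts (H j)" for i j z
    using disj that by (auto simp: disjoint_family_on_def)
  have "(x, y) \<notin> parcs (H i)" if i: "i \<in> pverts T" for i
  proof
    assume a: "(x, y) \<in> parcs (H i)"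
    interpret Hi: pair_digraph "H i" by (rule H[OF i])
    have "x \<in> pverts (H i)" "y \<in> pverts (H i)" using a Hi.wellformed' by auto
    then show False using uniq i uv xy by metis
  qed
  moreover have "i = u \<and> j = v"
    if "(i, j) \<in> parcs T" "x \<in> pverts (H i)" "y \<in> pverts (H j)" for i j
    using uniq that uv xy T.wellformed' by metis
  ultimately show ?thesis using xy by (auto simp: composition_def)
qed

lemma minimal_separator_composition_adjacent:
  fixes T :: "'i pair_pre_digraph" and H :: "'i \<Rightarrow> 'a pair_pre_digraph"
  defines "Q \<equiv> composition T H"
  assumes T: "pair_digraph T"
    and H: "\<And>u. u \<in> pverts T \<Longrightarrow> pair_digraph (H u)"
    and ne: "\<And>u. u \<in> pverts T \<Longrightarrow> pverts (H u) \<noteq> {}"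
    and disj: "disjoint_family_on (\<lambda>u. pverts (H u)) (pverts T)"
    and semi: "semicomplete T"
    and T1: "T \<notin> class_T1"
    and min: "minimal_separator (with_proj Q) S"
    and s: "s \<in> S" and x: "x \<in> pverts Q - S"
  shows "(s, x) \<in> parcs Q \<or> (x, s) \<in> parcs Q"
proof (rule ccontr)
  assume nadj: "\<not> ?thesis"
  interpret Q: pair_digraph Q
    unfolding Q_def by (rule pair_digraph_composition[OF T H disj])
  have sepI: "separator (with_proj Q) S'"
    if "A \<noteq> {}" "B \<noteq> {}" "A \<inter> B = {}" "A \<union> B = pverts Q - S'" "S' \<subseteq> pverts Q"
      "\<And>b a. b \<in> B \<Longrightarrow> a \<in> A \<Longrightarrow> (b, a) \<notin> parcs Q" for A B S'
    unfolding Q.separator_iff_cut using that by metis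
  have sep: "separator (with_proj Q) S"
    and minD: "\<And>S'. S' \<subset> S \<Longrightarrow> \<not> separator (with_proj Q) S'"
    using min by (auto simp: minimal_separator_def)
  have SV: "S \<subseteq> pverts Q" using sep by (simp add: separator_def)
  have arc: "(y, z) \<in> parcs Q \<longleftrightarrow> (v, w) \<in> parcs T"
    if "v \<in> pverts T" "w \<in> pverts T" "v \<noteq> w" "y \<in> pverts (H v)" "z \<in> pverts (H w)" for v w y z
    unfolding Q_def using parcs_composition_iff[OF T H disj] that by blast
  have in_factor: "\<exists>v\<in>pverts T. y \<in> pverts (H v)" if "y \<in> pverts Q" for y
    using that by (auto simp: Q_def composition_def)
  have factor_sub: "pverts (H v) \<subseteq> pverts Q" if "v \<in> pverts T" for v
    using that by (auto simp: Q_def composition_def)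
  have semi': "(v, w) \<in> parcs T \<or> (w, v) \<in> parcs T"
    if "v \<in> pverts T" "w \<in> pverts T" "v \<noteq> w" for v w
    using semi that by (auto simp: semicomplete_def)
  obtain u where u: "u \<in> pverts T" and su: "s \<in> pverts (H u)"
    using in_factor s SV by blast
  have xu: "x \<in> pverts (H u)"
    using in_factor[of x] x arc[OF u _ _ su] arc[OF _ u _ _ su] semi'[OF u] nadj by blast
  let ?U = "pverts (H u)"
  \<comment> \<open>Arcs between \<open>?U\<close> and a vertex outside depend only on
    \<open>T\<close>, so the vertices of \<open>?U\<close> are interchangeable as ends of such
    arcs.\<close>
  have twin_in: "(y, z) \<in> parcs Q \<longleftrightarrow> (y, z') \<in> parcs Q"
    and twin_out: "(z, y) \<in> parcs Q \<longleftrightarrow> (z', y) \<in> parcs Q"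
    if y: "y \<in> pverts Q - ?U" and z: "z \<in> ?U" "z' \<in> ?U" for y z z'
  proof -
    obtain v where v: "v \<in> pverts T" "y \<in> pverts (H v)" using in_factor y by blast
    then have "v \<noteq> u" using y by auto
    then show "(y, z) \<in> parcs Q \<longleftrightarrow> (y, z') \<in> parcs Q"
      "(z, y) \<in> parcs Q \<longleftrightarrow> (z', y) \<in> parcs Q"
      using arc v u z by metis+
  qed
  obtain A B where AB: "A \<noteq> {}" "B \<noteq> {}" "A \<inter> B = {}" "A \<union> B = pverts Q - S"
    and cut: "\<And>b a. b \<in> B \<Longrightarrow> a \<in> A \<Longrightarrow> (b, a) \<notin> parcs Q"
    using sep unfolding Q.separator_iff_cut by (elim conjE exE) metis
  have nsep: "\<not> separator (with_proj Q) (S - {s})" using minD s by blast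
  \<comment> \<open>Otherwise \<open>s\<close> could join the side \<open>A\<close>, making
    \<open>S - {s}\<close> a separator.\<close>
  have to_s: "\<exists>b\<in>B. (b, s) \<in> parcs Q"
  proof (rule ccontr)
    assume "\<not> ?thesis"
    then have "separator (with_proj Q) (S - {s})"
      using AB cut s SV by (intro sepI[of "insert s A" B]) auto
    then show False using nsep by blast
  qed
  \<comment> \<open>Otherwise \<open>s\<close> could join the side \<open>B\<close>.\<close>
  have from_s: "\<exists>a\<in>A. (s, a) \<in> parcs Q"
  proof (rule ccontr)
    assume "\<not> ?thesis"
    then have "separator (with_proj Q) (S - {s})"
      using AB cut s SV by (intro sepI[of A "insert s B"]) auto
    then show False using nsep by blast
  qed
  \<comment> \<open>One side is met by \<open>x\<close>, the other by a neighbour of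
    \<open>s\<close> there: outside \<open>?U\<close> it would have the same arc with
    \<open>x\<close>, an arc from \<open>B\<close> to \<open>A\<close>.\<close>
  have "A \<inter> ?U \<noteq> {} \<and> B \<inter> ?U \<noteq> {}"
  proof (cases "x \<in> A")
    case True
    obtain b where b: "b \<in> B" "(b, s) \<in> parcs Q" using to_s by blast
    have "b \<in> ?U"
    proof (rule ccontr)
      assume "b \<notin> ?U"
      then have "b \<in> pverts Q - ?U" using b(1) AB(4) by blast
      then have "(b, x) \<in> parcs Q" using twin_in[OF _ su xu] b(2) by simp
      then show False using cut[OF b(1) True] by simp
    qed
    then show ?thesis using True b(1) xu by blast
  next
    case False
    then have xB: "x \<in> B" using x AB(4) by blast
    obtain a where a: "a \<in> A" "(s, a) \<in> parcs Q" using from_s by blast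
    have "a \<in> ?U"
    proof (rule ccontr)
      assume "a \<notin> ?U"
      then have "a \<in> pverts Q - ?U" using a(1) AB(4) by blast
      then have "(x, a) \<in> parcs Q" using twin_out[OF _ su xu] a(2) by simp
      then show False using cut[OF xB a(1)] by simp
    qed
    then show ?thesis using xB a(1) xu by blast
  qed
  then obtain p q where p: "p \<in> A" "p \<in> ?U" and q: "q \<in> B" "q \<in> ?U" by blast
  \<comment> \<open>By interchangeability \<open>q\<close> replaces \<open>z\<close>, and no arc
    leads from \<open>q\<close> in \<open>B\<close> to \<open>y\<close> in \<open>A\<close>;
    \<open>p\<close> does the same for \<open>B_U\<close>.\<close>
  have U_A: "(z, y) \<notin> parcs Q" if "y \<in> A - ?U" "z \<in> ?U" for y z
  proof -
    have "y \<in> pverts Q - ?U" using that(1) AB(4) by blast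
    then show ?thesis using twin_out[OF _ that(2) q(2)] cut[OF q(1)] that(1) by simp
  qed
  have B_U: "(y, z) \<notin> parcs Q" if "y \<in> B - ?U" "z \<in> ?U" for y z
  proof -
    have "y \<in> pverts Q - ?U" using that(1) AB(4) by blast
    then show ?thesis using twin_in[OF _ that(2) p(2)] cut[OF _ p(1)] that(1) by simp
  qed
  have smaller: "S - ?U \<subset> S" using s su by blast
  have U_rest: "pverts Q - (S - ?U) = A \<union> B \<union> ?U" using AB(4) factor_sub[OF u] by blast
  consider "A - ?U \<noteq> {}" | "B - ?U \<noteq> {}" | "A \<union> B \<subseteq> ?U" by blast
  then show False
  proof cases
    case 1
    \<comment> \<open>All of \<open>?U\<close>, including its vertices in \<open>A\<close> and in
      \<open>S\<close>, moves to the side of \<open>B\<close>; the next case moves it to the side of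
      \<open>A\<close>.\<close>
    have "separator (with_proj Q) (S - ?U)"
    proof (rule sepI)
      show "(b, a) \<notin> parcs Q" if "b \<in> B \<union> ?U" "a \<in> A - ?U" for a b using that cut U_A by blast
      show "(A - ?U) \<union> (B \<union> ?U) = pverts Q - (S - ?U)" using U_rest by blast
    qed (use 1 AB(2,3) SV in blast)+
    then show False using minD smaller by blast
  next
    case 2
    have "separator (with_proj Q) (S - ?U)"
    proof (rule sepI)
      show "(b, a) \<notin> parcs Q" if "b \<in> B - ?U" "a \<in> A \<union> ?U" for a b using that cut B_U by blast
      show "(A \<union> ?U) \<union> (B - ?U) = pverts Q - (S - ?U)" using U_rest by blast
    qed (use 2 AB(1,3) SV in blast)+
    then show False using minD smaller by blast
  next
    case 3
    obtain w where w: "w \<in> pverts T" "w \<noteq> u" "(u, w) \<notin> parcs T \<or> (w, u) \<notin> parcs T"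
      using T1 T semi u unfolding class_T1_def by blast
    let ?W = "pverts (H w)"
    have UW: "?U \<inter> ?W = {}" using disj u w by (auto simp: disjoint_family_on_def)
    \<comment> \<open>Since \<open>A \<union> B\<close> lies in \<open>?U\<close>, putting both
      factors back leaves exactly \<open>?U \<union> ?W\<close>; the arc missing between
      \<open>u\<close> and \<open>w\<close> then decides which factor is which side of the
      cut.\<close>
    have rest: "pverts Q - (S - (?U \<union> ?W)) = ?U \<union> ?W"
      using 3 AB(4) factor_sub[OF u] factor_sub[OF w(1)] by blast
    have "S - (?U \<union> ?W) \<subset> S" using s su by blast
    then have nsep': "\<not> separator (with_proj Q) (S - (?U \<union> ?W))" by (rule minD)
    show False
    proof (cases "(u, w) \<in> parcs T")
      case True
      then have no: "\<forall>b\<in>?W. \<forall>a\<in>?U. (b, a) \<notin> parcs Q" using arc[OF w(1) u w(2)] w(3) by simp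
      have "separator (with_proj Q) (S - (?U \<union> ?W))"
      proof (rule sepI[of ?U ?W])
        show "?U \<union> ?W = pverts Q - (S - (?U \<union> ?W))" using rest by (simp add: Un_commute)
        show "(b, a) \<notin> parcs Q" if "b \<in> ?W" "a \<in> ?U" for a b using no that by simp
      qed (use ne[OF u] ne[OF w(1)] UW SV in auto)
      then show False using nsep' by blast
    next
      case False
      then have no: "\<forall>b\<in>?U. \<forall>a\<in>?W. (b, a) \<notin> parcs Q" using arc[OF u w(1) w(2)[symmetric]] by simp
      have "separator (with_proj Q) (S - (?U \<union> ?W))"
      proof (rule sepI[of ?W ?U])
        show "?W \<union> ?U = pverts Q - (S - (?U \<union> ?W))" using rest by (simp add: Un_commute)
        show "(b, a) \<notin> parcs Q" if "b \<in> ?U" "a \<in> ?W" for a b using no that by simp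
      qed (use ne[OF u] ne[OF w(1)] UW SV in auto)
      then show False using nsep' by blast
    qed
  qed
qed

text \<open>By symmetry the vertices reachable from \<open>u\<close> form its component, and a
  closed \<open>S\<close> contains this whole set for each \<open>u\<close> in
  \<open>S\<close>.\<close>

lemma (in sym_digraph) induce_closed_eq_Union_sccs:
  assumes S: "S \<subseteq> verts G"
    and closed: "\<And>u v. u \<in> S \<Longrightarrow> u \<rightarrow> v \<Longrightarrow> v \<in> S"
  shows "\<exists>\<C> \<subseteq> sccs. G \<restriction> S = Union \<C> \<and> S = (\<Union>C\<in>\<C>. verts C)"
proof -
  let ?c = "\<lambda>u. G \<restriction> {v. u \<rightarrow>\<^sup>* v}"
  have reach: "v \<in> S" if "u \<rightarrow>\<^sup>* v" "u \<in> S" for u v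
    using that by (induct rule: reachable_induct) (auto intro: closed)
  have verts: "S = (\<Union>C\<in>?c ` S. verts C)"
    using S reach by auto
  \<comment> \<open>An arc with tail in \<open>S\<close> lies in the component of its tail, as both
    ends are reachable from there.\<close>
  have "arcs (G \<restriction> S) = (\<Union>C\<in>?c ` S. arcs C)"
  proof (intro equalityI subsetI)
    fix e assume "e \<in> arcs (G \<restriction> S)"
    then have e: "e \<in> arcs G" "tail G e \<in> S" by auto
    then have "tail G e \<rightarrow>\<^sup>* tail G e" "tail G e \<rightarrow>\<^sup>* head G e"
      by (auto intro: in_arcs_imp_in_arcs_ends)
    with e have "e \<in> arcs (?c (tail G e))" by simp
    with e(2) show "e \<in> (\<Union>C\<in>?c ` S. arcs C)" by (intro UN_I[of "?c (tail G e)"]) auto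
  next
    fix e assume "e \<in> (\<Union>C\<in>?c ` S. arcs C)"
    then show "e \<in> arcs (G \<restriction> S)" using reach by auto
  qed
  with verts have "G \<restriction> S = Union (?c ` S)"
    by (simp add: Union_def induce_subgraph_def)
  moreover have "?c ` S \<subseteq> sccs" using S induce_reachable_is_in_sccs by blast
  ultimately show ?thesis using verts by blast
qed

theorem theorem2p2:
  fixes T :: "'i pair_pre_digraph"
    and H :: "'i \<Rightarrow> 'a pair_pre_digraph"
    and Q :: "'a pair_pre_digraph"
    and S :: "'a set"
  assumes "pair_digraph T"
    and "card (pverts T) \<ge> 2"
    and "\<And>u. u \<in> pverts T \<Longrightarrow> pair_digraph (H u)"
    and "\<And>u. u \<in> pverts T \<Longrightarrow> pverts (H u) \<noteq> {}"
    and "disjoint_family_on (\<lambda>u. pverts (H u)) (pverts T)"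
    and "Q = composition T H"
    and "semicomplete T"
    and "strong (with_proj Q)"
    and "T \<notin> class_T1"
    and "minimal_separator (with_proj Q) S"
  shows "(\<exists>\<C> \<subseteq> pre_digraph.sccs (with_proj (graph_complement (mk_symmetric (with_proj Q)))).
            with_proj (graph_complement (mk_symmetric (with_proj Q))) \<restriction> S =
              pre_digraph.Union (with_proj (graph_complement (mk_symmetric (with_proj Q)))) \<C> \<and>
            S = (\<Union>C\<in>\<C>. verts C)) \<and>
         (\<forall>s\<in>S. \<forall>x\<in>pverts Q - S. (s, x) \<in> parcs Q \<or> (x, s) \<in> parcs Q)"
proof -
  let ?G = "graph_complement (mk_symmetric (with_proj Q))"
  have Q: "pair_digraph Q"
    using pair_digraph_composition[OF assms(1,3,5)] assms(6) by simp
  interpret Q: pair_digraph Q by (rule Q)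
  interpret G: pair_graph ?G by (rule pair_graph_graph_complement_mk_symmetric[OF Q])
  have adj: "(s, x) \<in> parcs Q \<or> (x, s) \<in> parcs Q" if "s \<in> S" "x \<in> pverts Q - S" for s x
    using minimal_separator_composition_adjacent[OF assms(1,3,4,5,7,9)] assms(6,10) that by blast
  have "S \<subseteq> pverts ?G"
    using assms(10) by (simp add: minimal_separator_def separator_def graph_complement_def)
  \<comment> \<open>An edge of the complement leaving \<open>S\<close> would join vertices not
    adjacent in \<open>Q\<close>, against \<open>adj\<close>.\<close>
  moreover have "v \<in> S" if "u \<in> S" "(u, v) \<in> parcs ?G" for u v
    using that adj[of u v] by (force simp: graph_complement_def parcs_mk_symmetric)
  ultimately show ?thesis
    using G.induce_closed_eq_Union_sccs[of S] adj by blast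
qed

end
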